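(* Let $(X,X_+,\mathcal K,f)$ be an abstract state space, let $P$ be a projection on $X$, and let $T$ be an operator on $X$. Then $T$ is uniformly $P$-ergodic if and only if $T$ can be written as $T=P+Q$, where $Q$ is an operator on $X$ such that $PQ=QP=0$ and $\|Q^{n_0}\|<1$ for some $n_0\in\mathbb N$. Moreover, if $T\in\Sigma(X)$, then $$\delta_P(T)\le\|Q\|\le 2\,\delta_P(T).$$
   Context: Let $X$ be a real ordered vector space with generating cone $X_+$ ($X=X_+-X_+$), let $f$ be a strictly positive linear functional on $X$ ($f(x)>0$ for $x>0$), and let $\mathcal K=\{x\in X_+: f(x)=1\}$. Let $U$ be the convex hull of $\mathcal K\cup(-\mathcal K)$ and $\|x\|=\inf\{t\ge 0: x\in tU\}$. $(X,X_+,\mathcal K,f)$ is an abstract state space if this seminorm is a norm, $X$ is complete for it, and $X_+$ is closed; $X$ always carries this norm. Operators are bounded linear operators $X\to X$. An operator $T$ is Markov if it is positive ($Tx\ge0$ whenever $x\ge0$) and $T(\mathcal K)\subset\mathcal K$; $\Sigma(X)$ is the set of Markov operators on $X$. A projection is an operator $P$ with $P^2=P$. For a non-trivial projection $P$ and an operator $T$, $\delta_P(T)=\sup\{\|Tx\|/\|x\| : Px=0,\ x\ne0\}$; if $P=I$ (the identity), one puts $\delta_P(T)=1$. $T$ is uniformly $P$-ergodic if $\|T^n-P\|\to0$ as $n\to\infty$. $\mathbb N=\{1,2,\dots\}$.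
   Formalization: The lower bound δ_P(T) ≤ ‖Q‖ is stated only for P ≠ I: if P = I then Q = 0 and T = I, and with the convention δ_I(T) = 1 the bound would read 1 ≤ 0. *)

theory Defs
  imports "HOL-Analysis.Analysis"
begin

text \<open>
  The type class \<open>ordered_real_vector\<close> supplies the ordered vector space, with positive cone
  \<open>{x. 0 \<le> x}\<close>; the class \<open>banach\<close> supplies a complete norm, which the locale
  \<open>abstract_state_space\<close> below identifies with the Minkowski functional of \<open>unit_hull f\<close>.
\<close>

definition state_base :: "('a::ordered_real_vector \<Rightarrow> real) \<Rightarrow> 'a set" where
  "state_base f = {x. 0 \<le> x \<and> f x = 1}"

definition unit_hull :: "('a::ordered_real_vector \<Rightarrow> real) \<Rightarrow> 'a set" where
  "unit_hull f = convex hull (state_base f \<union> uminus ` state_base f)"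

locale abstract_state_space =
  fixes f :: "'a::{banach, ordered_real_vector} \<Rightarrow> real"
  assumes linear_f: "linear f"
    and strictly_positive: "\<And>x. 0 < x \<Longrightarrow> 0 < f x"
    and generating: "\<And>x::'a. \<exists>y z. 0 \<le> y \<and> 0 \<le> z \<and> x = y - z"
    and norm_gauge: "\<And>x. norm x = Inf {t. 0 \<le> t \<and> x \<in> (\<lambda>u. t *\<^sub>R u) ` unit_hull f}"
    and closed_cone: "closed {x::'a. 0 \<le> x}"

definition Markov_operators ::
    "('a::{banach, ordered_real_vector} \<Rightarrow> real) \<Rightarrow> ('a \<Rightarrow>\<^sub>L 'a) set" where
  "Markov_operators f =
    {T. (\<forall>x. 0 \<le> x \<longrightarrow> 0 \<le> blinfun_apply T x) \<and> blinfun_apply T ` state_base f \<subseteq> state_base f}"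

definition projection :: "('a::real_normed_vector \<Rightarrow>\<^sub>L 'a) \<Rightarrow> bool" where
  "projection P \<longleftrightarrow> P o\<^sub>L P = P"

primrec blinfun_power :: "('a::real_normed_vector \<Rightarrow>\<^sub>L 'a) \<Rightarrow> nat \<Rightarrow> ('a \<Rightarrow>\<^sub>L 'a)" where
  "blinfun_power T 0 = id_blinfun"
| "blinfun_power T (Suc n) = T o\<^sub>L blinfun_power T n"

text \<open>The supremum is over a nonempty set whenever \<open>P\<close> is a projection other than the identity.\<close>

definition ergodicity_coeff ::
    "('a::real_normed_vector \<Rightarrow>\<^sub>L 'a) \<Rightarrow> ('a \<Rightarrow>\<^sub>L 'a) \<Rightarrow> real" where
  "ergodicity_coeff P T =
    (if P = id_blinfun then 1
     else (SUP x\<in>{x. blinfun_apply P x = 0 \<and> x \<noteq> 0}. norm (blinfun_apply T x) / norm x))"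

definition uniformly_ergodic ::
    "('a::real_normed_vector \<Rightarrow>\<^sub>L 'a) \<Rightarrow> ('a \<Rightarrow>\<^sub>L 'a) \<Rightarrow> bool" where
  "uniformly_ergodic P T \<longleftrightarrow> (\<lambda>n. norm (blinfun_power T n - P)) \<longlonglongrightarrow> 0"

end

theory Submission
  imports Defs
begin

text \<open>
  Write \<open>Q = T - P\<close>.  Uniform convergence \<open>T\<^sup>n \<rightarrow> P\<close> forces \<open>T P = P T = P\<close>, because \<open>T\<^sup>n\<^sup>+\<^sup>1\<close> is both
  \<open>T T\<^sup>n\<close> and \<open>T\<^sup>n T\<close>.  With \<open>P\<^sup>2 = P\<close> this says exactly \<open>P Q = Q P = 0\<close>.  Whenever \<open>P Q = Q P = 0\<close>,
  all mixed terms in \<open>(P + Q)\<^sup>n\<close> vanish, so \<open>T\<^sup>n - P = Q\<^sup>n\<close> for \<open>n \<ge> 1\<close> (\<open>blinfun_power_split\<close>), and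
  uniform ergodicity means \<open>Q\<^sup>n \<rightarrow> 0\<close>.  For a submultiplicative norm that is equivalent to a single
  power of \<open>Q\<close> having norm below one (\<open>power_tendsto_zero_of_contractive_power\<close>).

  For the estimate, \<open>T\<close> and \<open>Q\<close> agree on the kernel of \<open>P\<close>, which gives the lower bound at once.
  Since \<open>Q x = Q (x - P x) = T (x - P x)\<close> with \<open>x - P x\<close> in that kernel, the upper bound needs only
  \<open>\<parallel>I - P\<parallel> \<le> 2\<close>, hence \<open>\<parallel>P\<parallel> \<le> 1\<close>.  This is where the order enters: a Markov operator maps the hull
  of \<open>K \<union> -K\<close>, whose gauge is the norm, into itself, so it is a contraction
  (\<open>Markov_norm_le_1\<close>), and \<open>P\<close> is a norm limit of the contractions \<open>T\<^sup>n\<close>.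
\<close>

section \<open>Powers of bounded operators\<close>

lemmas blinfun_compose_linear =
  bounded_bilinear.add_left[OF bounded_bilinear_blinfun_compose]
  bounded_bilinear.add_right[OF bounded_bilinear_blinfun_compose]
  bounded_bilinear.diff_left[OF bounded_bilinear_blinfun_compose]
  bounded_bilinear.diff_right[OF bounded_bilinear_blinfun_compose]

lemma blinfun_compose_id [simp]: "A o\<^sub>L id_blinfun = A" "id_blinfun o\<^sub>L A = A"
  by (auto intro!: blinfun_eqI)

lemma blinfun_compose_assoc: "(A o\<^sub>L B) o\<^sub>L C = A o\<^sub>L (B o\<^sub>L C)"
  by (auto intro!: blinfun_eqI)

lemma blinfun_power_add:
  "blinfun_power A (m + n) = blinfun_power A m o\<^sub>L blinfun_power A n"
  by (induction m) (simp_all add: blinfun_compose_assoc)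

lemma blinfun_power_Suc_right: "blinfun_power A (Suc n) = blinfun_power A n o\<^sub>L A"
  using blinfun_power_add[of A n 1] by simp

lemma norm_blinfun_power_le_1:
  assumes "norm A \<le> 1"
  shows "norm (blinfun_power A n) \<le> 1"
proof (induction n)
  case 0
  show ?case by (simp add: norm_blinfun_id_le)
next
  case (Suc n)
  have "norm (blinfun_power A (Suc n)) \<le> norm A * norm (blinfun_power A n)"
    by (simp add: norm_blinfun_compose)
  also have "\<dots> \<le> 1 * 1"
    using assms Suc by (intro mult_mono) auto
  finally show ?case by simp
qed

text \<open>
  Dividing \<open>n\<close> by \<open>m\<close> with remainder bounds \<open>\<parallel>A\<^sup>n\<parallel>\<close> by the geometric term \<open>\<parallel>A\<^sup>m\<parallel>\<^bsup>n div m\<^esup>\<close>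
  times a constant that dominates the norms of the finitely many powers below \<open>m\<close>.
\<close>

lemma power_tendsto_zero_of_contractive_power:
  fixes A :: "'a::real_normed_vector \<Rightarrow>\<^sub>L 'a"
  assumes "1 \<le> m" and "norm (blinfun_power A m) < 1"
  shows "blinfun_power A \<longlonglongrightarrow> 0"
proof -
  define r where "r = norm (blinfun_power A m)"
  define C where "C = (\<Sum>j<m. norm (blinfun_power A j))"
  have multiple: "norm (blinfun_power A (q * m + j)) \<le> r ^ q * norm (blinfun_power A j)" for q j
  proof (induction q)
    case 0
    show ?case by simp
  next
    case (Suc q)
    have "norm (blinfun_power A (Suc q * m + j)) \<le> r * norm (blinfun_power A (q * m + j))"
      using norm_blinfun_compose[of "blinfun_power A m" "blinfun_power A (q * m + j)"]
      by (simp add: r_def blinfun_power_add[symmetric] add.assoc)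
    also have "\<dots> \<le> r * (r ^ q * norm (blinfun_power A j))"
      using Suc by (intro mult_left_mono) (auto simp: r_def)
    finally show ?case by (simp add: mult.assoc)
  qed
  have bound: "norm (blinfun_power A n) \<le> r ^ (n div m) * C" for n
  proof -
    have "norm (blinfun_power A (n mod m)) \<le> C"
      unfolding C_def using assms(1) by (intro member_le_sum) auto
    then have "r ^ (n div m) * norm (blinfun_power A (n mod m)) \<le> r ^ (n div m) * C"
      by (intro mult_left_mono) (auto simp: r_def)
    then show ?thesis
      using multiple[of "n div m" "n mod m"] by simp
  qed
  have "filterlim (\<lambda>n. n div m) sequentially sequentially"
    unfolding filterlim_at_top
  proof
    fix Z
    have "Z \<le> n div m" if "Z * m \<le> n" for n
      using div_le_mono[OF that, of m] assms(1) by simp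
    then show "eventually (\<lambda>n. Z \<le> n div m) sequentially"
      unfolding eventually_sequentially by blast
  qed
  moreover have "(\<lambda>q. r ^ q) \<longlonglongrightarrow> 0"
    using assms(2) by (intro LIMSEQ_power_zero) (simp add: r_def)
  ultimately have "(\<lambda>n. r ^ (n div m)) \<longlonglongrightarrow> 0"
    by (rule filterlim_compose[rotated])
  then have "(\<lambda>n. r ^ (n div m) * C) \<longlonglongrightarrow> 0"
    by (rule tendsto_mult_left_zero)
  then show ?thesis
    by (rule Lim_null_comparison[rotated]) (simp add: bound)
qed

section \<open>Splitting off the limit projection\<close>

text \<open>Every mixed product contains \<open>P Q\<close> or \<open>Q P\<close>, so only the pure powers survive.  The exponent
  starts at one: at exponent zero the left side is \<open>I\<close> and the right side would be \<open>P + I\<close>.\<close>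

lemma blinfun_power_split:
  assumes "P o\<^sub>L P = P" and "P o\<^sub>L Q = 0" and "Q o\<^sub>L P = 0"
  shows "blinfun_power (P + Q) (Suc n) = P + blinfun_power Q (Suc n)"
proof (induction n)
  case 0
  show ?case by simp
next
  case (Suc n)
  have "P o\<^sub>L blinfun_power Q (Suc n) = (P o\<^sub>L Q) o\<^sub>L blinfun_power Q n"
    by (simp add: blinfun_compose_assoc)
  also have "\<dots> = 0"
    using assms(2) by simp
  finally have "P o\<^sub>L blinfun_power Q (Suc n) = 0" .
  moreover have "blinfun_power (P + Q) (Suc (Suc n)) = (P + Q) o\<^sub>L (P + blinfun_power Q (Suc n))"
    unfolding blinfun_power.simps(2)[of "P + Q" "Suc n"] Suc by (rule refl)
  ultimately show ?case
    using assms by (simp add: blinfun_compose_linear)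
qed

lemma uniformly_ergodic_iff: "uniformly_ergodic P T \<longleftrightarrow> blinfun_power T \<longlonglongrightarrow> P"
  unfolding uniformly_ergodic_def by (metis LIM_zero_iff tendsto_norm_zero_iff)

lemma uniformly_ergodic_sum_iff:
  assumes "projection P" and "P o\<^sub>L Q = 0" and "Q o\<^sub>L P = 0"
  shows "uniformly_ergodic P (P + Q) \<longleftrightarrow> blinfun_power Q \<longlonglongrightarrow> 0"
proof -
  have "blinfun_power (P + Q) (Suc n) - P = blinfun_power Q (Suc n)" for n
    using blinfun_power_split[of P Q n] assms by (simp add: projection_def)
  then have "uniformly_ergodic P (P + Q) \<longleftrightarrow> (\<lambda>n. blinfun_power Q (Suc n)) \<longlonglongrightarrow> 0"
    unfolding uniformly_ergodic_iff
    by (subst filterlim_sequentially_Suc[symmetric], subst LIM_zero_iff[symmetric]) presburger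
  then show ?thesis
    by (simp only: filterlim_sequentially_Suc)
qed

text \<open>Both identities compare the limit of \<open>T\<^sup>n\<^sup>+\<^sup>1\<close> with that of the shifted sequence.\<close>

lemma uniformly_ergodic_absorb:
  assumes "uniformly_ergodic P T"
  shows "T o\<^sub>L P = P" and "P o\<^sub>L T = P"
proof -
  have lim: "blinfun_power T \<longlonglongrightarrow> P"
    using assms by (simp only: uniformly_ergodic_iff)
  then have lim_Suc: "(\<lambda>n. blinfun_power T (Suc n)) \<longlonglongrightarrow> P"
    by (rule LIMSEQ_Suc)
  have "(\<lambda>n. blinfun_power T (Suc n)) \<longlonglongrightarrow> (T o\<^sub>L P)"
    unfolding blinfun_power.simps(2)
    by (intro bounded_bilinear.tendsto[OF bounded_bilinear_blinfun_compose] tendsto_const lim)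
  then show "T o\<^sub>L P = P"
    using lim_Suc by (rule LIMSEQ_unique)
  have "(\<lambda>n. blinfun_power T (Suc n)) \<longlonglongrightarrow> (P o\<^sub>L T)"
    unfolding blinfun_power_Suc_right
    by (intro bounded_bilinear.tendsto[OF bounded_bilinear_blinfun_compose] tendsto_const lim)
  then show "P o\<^sub>L T = P"
    using lim_Suc by (rule LIMSEQ_unique)
qed

lemma uniformly_ergodic_iff_decomposition:
  assumes "projection P"
  shows "uniformly_ergodic P T \<longleftrightarrow>
           (\<exists>Q. T = P + Q \<and> P o\<^sub>L Q = 0 \<and> Q o\<^sub>L P = 0 \<and>
                (\<exists>n0\<ge>1. norm (blinfun_power Q n0) < 1))" (is "_ \<longleftrightarrow> (\<exists>Q. ?dec Q)")
proof
  assume erg: "uniformly_ergodic P T"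
  define Q where "Q = T - P"
  have Q: "T = P + Q" "P o\<^sub>L Q = 0" "Q o\<^sub>L P = 0"
    using uniformly_ergodic_absorb[OF erg] assms
    by (simp_all add: Q_def projection_def blinfun_compose_linear)
  have "blinfun_power Q \<longlonglongrightarrow> 0"
    using erg uniformly_ergodic_sum_iff[OF assms Q(2,3)] Q(1) by simp
  then obtain N where "\<forall>n\<ge>N. norm (blinfun_power Q n) < 1"
    using LIMSEQ_D[of "blinfun_power Q" 0 1] by auto
  then have "norm (blinfun_power Q (Suc N)) < 1"
    by (meson le_SucI order_refl)
  then have "\<exists>n0\<ge>1. norm (blinfun_power Q n0) < 1"
    by (intro exI[of _ "Suc N"] conjI) simp_all
  with Q show "\<exists>Q. ?dec Q"
    by blast
next
  assume "\<exists>Q. ?dec Q"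
  then obtain Q n0 where Q: "T = P + Q" "P o\<^sub>L Q = 0" "Q o\<^sub>L P = 0"
    and n0: "1 \<le> n0" "norm (blinfun_power Q n0) < 1"
    by blast
  show "uniformly_ergodic P T"
    using power_tendsto_zero_of_contractive_power[OF n0] uniformly_ergodic_sum_iff[OF assms Q(2,3)]
      Q(1) by simp
qed

section \<open>Markov operators are contractions\<close>

context abstract_state_space
begin

lemma nonneg_eq_scaled_state:
  assumes "0 \<le> y" and "y \<noteq> 0"
  obtains k where "k \<in> state_base f" and "y = f y *\<^sub>R k" and "0 < f y"
proof -
  have pos: "0 < f y"
    using assms by (intro strictly_positive) auto
  then have "f (y /\<^sub>R f y) = 1"
    by (simp add: linear_scale[OF linear_f])
  then have "y /\<^sub>R f y \<in> state_base f"
    using assms pos by (simp add: state_base_def scaleR_nonneg_nonneg)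
  with pos show ?thesis
    using that by simp
qed

text \<open>
  A point \<open>y - z\<close> with \<open>y, z\<close> in the cone is \<open>f y + f z\<close> times a convex combination of a state and a
  negative state.  The origin is left out because the hull is empty when the space is zero.
\<close>

lemma unit_hull_absorbing:
  assumes "x \<noteq> 0"
  shows "\<exists>t\<ge>0. x \<in> (\<lambda>u. t *\<^sub>R u) ` unit_hull f"
proof -
  obtain y z where yz: "0 \<le> y" "0 \<le> z" "x = y - z"
    using generating by blast
  have plus: "k \<in> unit_hull f" and minus: "- k \<in> unit_hull f" if "k \<in> state_base f" for k
    using that unfolding unit_hull_def by (auto intro!: hull_inc)
  consider "z = 0" "y \<noteq> 0" | "y = 0" "z \<noteq> 0" | "y \<noteq> 0" "z \<noteq> 0"
    using assms yz by auto
  then show ?thesis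
  proof cases
    case 1
    then obtain k where "k \<in> state_base f" "y = f y *\<^sub>R k" "0 < f y"
      using nonneg_eq_scaled_state yz by metis
    then show ?thesis
      using 1 yz plus by (intro exI[of _ "f y"]) auto
  next
    case 2
    then obtain k where "k \<in> state_base f" "z = f z *\<^sub>R k" "0 < f z"
      using nonneg_eq_scaled_state yz by metis
    then have "x = f z *\<^sub>R (- k)" "- k \<in> unit_hull f" "0 \<le> f z"
      using 2 yz minus by auto
    then show ?thesis by blast
  next
    case 3
    then obtain k l where k: "k \<in> state_base f" "y = f y *\<^sub>R k" "0 < f y"
      and l: "l \<in> state_base f" "z = f z *\<^sub>R l" "0 < f z"
      using nonneg_eq_scaled_state yz by metis
    define t where "t = f y + f z"
    have t: "0 < t" "f y / t + f z / t = 1"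
      using k l by (auto simp: t_def add_divide_distrib[symmetric])
    have "convex (unit_hull f)"
      unfolding unit_hull_def by (rule convex_convex_hull)
    then have "(f y / t) *\<^sub>R k + (f z / t) *\<^sub>R (- l) \<in> unit_hull f"
      using plus minus k l t by (intro convexD) auto
    moreover have "x = t *\<^sub>R ((f y / t) *\<^sub>R k + (f z / t) *\<^sub>R (- l))"
      using k(2) l(2) yz(3) t(1) by (simp add: scaleR_add_right scaleR_diff_right)
    ultimately show ?thesis
      using t(1) by (intro exI[of _ t]) auto
  qed
qed

lemma Markov_unit_hull:
  assumes "T \<in> Markov_operators f" and "u \<in> unit_hull f"
  shows "blinfun_apply T u \<in> unit_hull f"
proof -
  have lin: "linear (blinfun_apply T)"
    using blinfun.bounded_linear_right by (rule bounded_linear.linear)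
  have "blinfun_apply T ` (state_base f \<union> uminus ` state_base f)
          \<subseteq> state_base f \<union> uminus ` state_base f"
    using assms(1) unfolding Markov_operators_def by (auto simp: blinfun.minus_right)
  then have "blinfun_apply T ` unit_hull f \<subseteq> unit_hull f"
    unfolding unit_hull_def convex_hull_linear_image[OF lin] by (rule hull_mono)
  then show ?thesis
    using assms(2) by blast
qed

text \<open>
  Every \<open>t\<close> with \<open>x \<in> t U\<close> also satisfies \<open>T x \<in> t U\<close>, so the infimum defining \<open>\<parallel>T x\<parallel>\<close> is taken
  over a larger set.  Real infima respect this only for a nonempty smaller set, which is what
  \<open>unit_hull_absorbing\<close> provides.
\<close>

lemma Markov_norm_le_1:
  assumes "T \<in> Markov_operators f"
  shows "norm T \<le> 1"
proof (rule norm_blinfun_bound)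
  fix x :: 'a
  show "norm (blinfun_apply T x) \<le> 1 * norm x"
  proof (cases "x = 0")
    case True
    then show ?thesis by simp
  next
    case False
    let ?scales = "\<lambda>x. {t. 0 \<le> t \<and> x \<in> (\<lambda>u. t *\<^sub>R u) ` unit_hull f}"
    have "?scales x \<subseteq> ?scales (blinfun_apply T x)"
      using Markov_unit_hull[OF assms] by (auto simp: blinfun.scaleR_right)
    moreover have "?scales x \<noteq> {}"
      using unit_hull_absorbing[OF False] by blast
    moreover have "bdd_below (?scales (blinfun_apply T x))"
      by (rule bdd_belowI[of _ 0]) simp
    ultimately have "Inf (?scales (blinfun_apply T x)) \<le> Inf (?scales x)"
      by (intro cInf_superset_mono)
    then show ?thesis
      by (simp add: norm_gauge)
  qed
qed simp

lemma uniformly_ergodic_Markov_limit_norm_le_1: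
  assumes "uniformly_ergodic P T" and "T \<in> Markov_operators f"
  shows "norm P \<le> 1"
proof (rule tendsto_upperbound)
  show "(\<lambda>n. norm (blinfun_power T n)) \<longlonglongrightarrow> norm P"
    using assms(1) unfolding uniformly_ergodic_iff by (rule tendsto_norm)
qed (simp_all add: norm_blinfun_power_le_1 Markov_norm_le_1[OF assms(2)])

end

section \<open>The ergodicity coefficient and the norm of the remainder\<close>

text \<open>The quotients are bounded by the operator norm, so the supremum is a genuine one.\<close>

lemma norm_le_ergodicity_coeff:
  assumes "P \<noteq> id_blinfun" and "blinfun_apply P y = 0"
  shows "norm (blinfun_apply T y) \<le> ergodicity_coeff P T * norm y"
proof (cases "y = 0")
  case True
  then show ?thesis by simp
next
  case False
  have "bdd_above ((\<lambda>x. norm (blinfun_apply T x) / norm x) ` {x. blinfun_apply P x = 0 \<and> x \<noteq> 0})"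
    by (rule bdd_aboveI[of _ "norm T"]) (auto simp: divide_le_eq norm_blinfun)
  then have "norm (blinfun_apply T y) / norm y \<le> ergodicity_coeff P T"
    unfolding ergodicity_coeff_def using assms False by (auto intro!: cSUP_upper)
  then show ?thesis
    using False by (simp add: divide_le_eq)
qed

lemma projection_kernel: "projection P \<Longrightarrow> blinfun_apply P (x - blinfun_apply P x) = 0"
  unfolding projection_def
  by (metis blinfun.diff_right blinfun_apply_blinfun_compose diff_self)

lemma ergodicity_coeff_le_norm_remainder:
  assumes "projection P" and "P \<noteq> id_blinfun"
  shows "ergodicity_coeff P (P + Q) \<le> norm Q"
proof -
  obtain x where "blinfun_apply P x \<noteq> x"
    using assms(2) by (metis blinfun_eqI blinfun_apply_id_blinfun id_apply)
  then have "{x. blinfun_apply P x = 0 \<and> x \<noteq> 0} \<noteq> {}"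
    using projection_kernel[OF assms(1), of x] by (auto intro!: exI[of _ "x - blinfun_apply P x"])
  then show ?thesis
    unfolding ergodicity_coeff_def using assms(2)
    by (auto intro!: cSUP_least simp: divide_le_eq norm_blinfun blinfun.add_left)
qed

lemma ergodicity_coeff_nonneg:
  assumes "projection P" and "P \<noteq> id_blinfun"
  shows "0 \<le> ergodicity_coeff P T"
proof -
  obtain x where "blinfun_apply P x \<noteq> x"
    using assms(2) by (metis blinfun_eqI blinfun_apply_id_blinfun id_apply)
  then have "0 < norm (x - blinfun_apply P x)"
    by simp
  moreover have "0 \<le> ergodicity_coeff P T * norm (x - blinfun_apply P x)"
    using norm_le_ergodicity_coeff[OF assms(2) projection_kernel[OF assms(1)]]
    by (rule order_trans[OF norm_ge_zero])
  ultimately show ?thesis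
    by (simp add: zero_le_mult_iff)
qed

lemma norm_remainder_le_ergodicity_coeff:
  assumes "projection P" and "P \<noteq> id_blinfun" and "Q o\<^sub>L P = 0"
  shows "norm Q \<le> norm (id_blinfun - P) * ergodicity_coeff P (P + Q)"
proof -
  let ?\<delta> = "ergodicity_coeff P (P + Q)"
  have coeff_nonneg: "0 \<le> ?\<delta>"
    using assms(1,2) by (rule ergodicity_coeff_nonneg)
  show ?thesis
  proof (rule norm_blinfun_bound)
    fix x
    have "blinfun_apply Q (blinfun_apply P x) = 0"
      using assms(3) by (metis blinfun_apply_blinfun_compose zero_blinfun.rep_eq)
    then have "blinfun_apply Q x = blinfun_apply (P + Q) (x - blinfun_apply P x)"
      using projection_kernel[OF assms(1), of x] by (simp add: blinfun.add_left blinfun.diff_right)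
    then have "norm (blinfun_apply Q x) \<le> ?\<delta> * norm (x - blinfun_apply P x)"
      using norm_le_ergodicity_coeff[OF assms(2) projection_kernel[OF assms(1)]] by metis
    also have "\<dots> \<le> ?\<delta> * (norm (id_blinfun - P) * norm x)"
      using norm_blinfun[of "id_blinfun - P" x] coeff_nonneg
      by (intro mult_left_mono) (simp_all add: blinfun.diff_left)
    finally show "norm (blinfun_apply Q x) \<le> norm (id_blinfun - P) * ?\<delta> * norm x"
      by (simp only: mult_ac)
  qed (simp add: coeff_nonneg)
qed

lemma (in abstract_state_space) norm_remainder_le_2_ergodicity_coeff:
  assumes "projection P" and "uniformly_ergodic P (P + Q)" and "Q o\<^sub>L P = 0"
    and "P + Q \<in> Markov_operators f"
  shows "norm Q \<le> 2 * ergodicity_coeff P (P + Q)"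
proof (cases "P = id_blinfun")
  case True
  then have "Q = 0"
    using assms(3) by simp
  then show ?thesis
    using True by (simp add: ergodicity_coeff_def)
next
  case False
  have "norm (id_blinfun - P) \<le> norm (id_blinfun :: 'a \<Rightarrow>\<^sub>L 'a) + norm P"
    by (rule norm_triangle_ineq4)
  also have "\<dots> \<le> 2"
    using norm_blinfun_id_le[where 'a='a]
      uniformly_ergodic_Markov_limit_norm_le_1[OF assms(2,4)] by linarith
  finally have le_2: "norm (id_blinfun - P) \<le> 2" .
  have "norm Q \<le> norm (id_blinfun - P) * ergodicity_coeff P (P + Q)"
    using assms(1) False assms(3) by (rule norm_remainder_le_ergodicity_coeff)
  also have "\<dots> \<le> 2 * ergodicity_coeff P (P + Q)"
    using le_2 ergodicity_coeff_nonneg[OF assms(1) False] by (rule mult_right_mono)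
  finally show ?thesis .
qed

theorem theorem5p2:
  fixes f :: "'a::{banach, ordered_real_vector} \<Rightarrow> real"
    and P T :: "'a \<Rightarrow>\<^sub>L 'a"
  assumes "abstract_state_space f"
    and "projection P"
  shows "(uniformly_ergodic P T \<longleftrightarrow>
           (\<exists>Q. T = P + Q \<and> P o\<^sub>L Q = 0 \<and> Q o\<^sub>L P = 0 \<and>
                (\<exists>n0\<ge>1. norm (blinfun_power Q n0) < 1))) \<and>
         (\<forall>Q. T = P + Q \<and> P o\<^sub>L Q = 0 \<and> Q o\<^sub>L P = 0 \<and>
                (\<exists>n0\<ge>1. norm (blinfun_power Q n0) < 1) \<and>
              T \<in> Markov_operators f \<longrightarrow>
              (P \<noteq> id_blinfun \<longrightarrow> ergodicity_coeff P T \<le> norm Q) \<and>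
              norm Q \<le> 2 * ergodicity_coeff P T)"
proof (intro conjI allI impI)
  show "uniformly_ergodic P T \<longleftrightarrow>
           (\<exists>Q. T = P + Q \<and> P o\<^sub>L Q = 0 \<and> Q o\<^sub>L P = 0 \<and>
                (\<exists>n0\<ge>1. norm (blinfun_power Q n0) < 1))"
    using assms(2) by (rule uniformly_ergodic_iff_decomposition)
next
  fix Q
  assume Q: "T = P + Q \<and> P o\<^sub>L Q = 0 \<and> Q o\<^sub>L P = 0 \<and>
      (\<exists>n0\<ge>1. norm (blinfun_power Q n0) < 1) \<and> T \<in> Markov_operators f"
  then have "uniformly_ergodic P T"
    using uniformly_ergodic_iff_decomposition[OF assms(2)] by blast
  with Q show "norm Q \<le> 2 * ergodicity_coeff P T"
    using abstract_state_space.norm_remainder_le_2_ergodicity_coeff[OF assms] by blast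
  assume "P \<noteq> id_blinfun"
  with Q show "ergodicity_coeff P T \<le> norm Q"
    using ergodicity_coeff_le_norm_remainder[OF assms(2)] by blast
qed

end
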